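(* Let $k\in\mathrm{Pos}^s_\nu$ and $(P,t)\in\mathcal{L}(A,Q)$. Then: 1. $\mathbf{K}^{\rm lyap}_\nu(k,P,t)$ is well-defined, i.e. it is a natural integer; 2. $\mathbf{K}^{\rm lyap}_\nu(k,P,t)=\min\{j\in\mathbb{N} : H_{P,t}(\|A\|_P^j)<\nu_k\}=\min\{j\in\mathbb{N} : \|A\|_P^j<H_{P,t}^{-1}(\nu_k)\}$; 3. $\mathbf{K}^{\rm lyap}_\nu(k,P,t)\geq k+1$; 4. for all integers $j\geq \mathbf{K}^{\rm lyap}_\nu(k,P,t)$, $\nu_j<\nu_k$; 5. for all $j\in\mathrm{Pos}^s_\nu$, if $\nu_j\leq\nu_k$ then $\mathbf{K}^{\rm lyap}_\nu(k,P,t)\leq \mathbf{K}^{\rm lyap}_\nu(j,P,t)$.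
   Context: Data: $d\geq 1$, $A\in\mathbb{R}^{d\times d}$, $Q\in\mathbb{R}^{d\times d}$ symmetric, $q\in\mathbb{R}^d$, and $X^{\rm in}\subset\mathbb{R}^d$ a nonempty polytope (bounded). Standing assumptions: $0<\rho(A)<1$ ($\rho$ = spectral radius); $X^{\rm in}\neq\{0\}$; if $Q\preceq 0$ then $q\neq 0$. $\mathbb{N}$ contains $0$, $\mathbb{R}_+=[0,+\infty)$. For $k\in\mathbb{N}$, $\nu_k:=\max_{x\in X^{\rm in}}\left(x^\intercal (A^k)^\intercal Q A^k x+q^\intercal A^k x\right)$, and $\mathrm{Pos}^s_\nu:=\{k\in\mathbb{N}:\nu_k>0\}$. For Hermitian matrices, $B\succ0$ (resp. $B\succeq 0$) means positive definite (resp. semidefinite). $\mathcal{L}_A:=\{P\in\mathbb{C}^{d\times d}\text{ Hermitian}: P\succ 0,\ P-A^\intercal PA\succ 0\}$. For $P\succ 0$: $\|x\|_P:=\sqrt{x^*Px}$ on $\mathbb{C}^d$, $\|A\|_P:=\max_{x\neq0}\|Ax\|_P/\|x\|_P$, $\|y\|_P^*:=\sqrt{y^*P^{-1}y}$, $\mu(P):=\max_{x\in X^{\rm in}}x^\intercal Px$, and $\mathcal{T}_Q(P):=\{t\in\mathbb{R}_+: tP-Q\succeq0\}$. Let $\mathcal{L}(A,Q):=\{(P,t): P\in\mathcal{L}_A,\ t\in\mathcal{T}_Q(P)\}$. For $(P,t)\in\mathcal{L}(A,Q)$ and $x\in\mathbb{R}_+$, $H_{P,t}(x):=x\sqrt{\mu(P)}\,\|q\|_P^*$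 if $t=0$, and $H_{P,t}(x):=\left(\sqrt{t\mu(P)}\,x+\frac{\|q\|_P^*}{2\sqrt t}\right)^2-\frac{(\|q\|_P^* )^2}{4t}$ if $t>0$. It is a strictly increasing homeomorphism of $\mathbb{R}_+$, with inverse $H_{P,t}^{-1}$. Standing assumption: $\nu_0<H_{P,t}(1)$ for all $(P,t)\in\mathcal{L}(A,Q)$. For $k\in\mathrm{Pos}^s_\nu$ and $(P,t)\in\mathcal{L}(A,Q)$: $\mathbf{K}^{\rm lyap}_\nu(k,P,t):=\left\lfloor \frac{\ln\left(H_{P,t}^{-1}(\nu_k)\right)}{\ln\|A\|_P}\right\rfloor+1$. *)

theory Defs
  imports "HOL-Analysis.Analysis"
begin

section \<open>Maxima of real functions\<close>

text \<open>The maximum is the greatest element of the image; the value is unspecified if the supremum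
  is not attained. (\<^const>\<open>Max\<close> is only meaningful on finite sets.)\<close>

definition max_over :: "'a set \<Rightarrow> ('a \<Rightarrow> real) \<Rightarrow> real" where
  "max_over S f = (GREATEST m. m \<in> f ` S)"

lemma max_over_eqI:
  assumes "x \<in> S" and "\<And>y. y \<in> S \<Longrightarrow> f y \<le> f x"
  shows "max_over S f = f x"
  unfolding max_over_def by (rule Greatest_equality) (use assms in auto)

lemma max_over_compact:
  fixes f :: "'a::topological_space \<Rightarrow> real"
  assumes "compact S" "S \<noteq> {}" "continuous_on S f"
  shows "\<exists>x\<in>S. max_over S f = f x \<and> (\<forall>y\<in>S. f y \<le> f x)"
  using continuous_attains_sup[OF assms] max_over_eqI by metis


section \<open>Complex matrices\<close>

text \<open>The operation \<open>*\<close>, and hence \<open>^\<close>, on the type of matrices is componentwise, so the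
  matrix power is defined separately.\<close>

primrec mat_pow :: "'a::semiring_1^'n^'n \<Rightarrow> nat \<Rightarrow> 'a^'n^'n" where
  "mat_pow A 0 = mat 1"
| "mat_pow A (Suc k) = A ** mat_pow A k"

definition cvec :: "real^'n \<Rightarrow> complex^'n" where
  "cvec x = (\<chi> i. complex_of_real (x $ i))"

abbreviation cmat :: "real^'n^'m \<Rightarrow> complex^'n^'m" where
  "cmat \<equiv> map_matrix complex_of_real"

definition spectrum :: "complex^'n^'n \<Rightarrow> complex set" where
  "spectrum A = {l. \<exists>v. v \<noteq> 0 \<and> A *v v = l *s v}"

definition spectral_radius :: "real^'n^'n \<Rightarrow> real" where
  "spectral_radius A = max_over (spectrum (cmat A)) cmod"

definition hermitian :: "complex^'n^'n \<Rightarrow> bool" where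
  "hermitian B \<longleftrightarrow> map_matrix cnj (transpose B) = B"

text \<open>The form \<open>x\<^sup>* B x\<close>. It is real for Hermitian \<open>B\<close>, so that taking its real part below is
  only a type conversion.\<close>

definition qform :: "complex^'n^'n \<Rightarrow> complex^'n \<Rightarrow> complex" where
  "qform B x = (\<Sum>i\<in>UNIV. cnj (x $ i) * (B *v x) $ i)"

lemma hermitian_qform_real:
  assumes "hermitian B"
  shows "qform B x \<in> \<real>"
proof -
  have B: "cnj (B $ i $ j) = B $ j $ i" for i j
  proof -
    have "map_matrix cnj (transpose B) $ j $ i = B $ j $ i"
      using assms by (simp only: hermitian_def)
    then show ?thesis
      by (simp add: transpose_def)
  qed
  have "cnj (qform B x) = (\<Sum>i\<in>UNIV. \<Sum>j\<in>UNIV. x $ i * (B $ j $ i * cnj (x $ j)))"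
    by (simp add: qform_def matrix_vector_mult_def sum_distrib_left B)
  also have "\<dots> = (\<Sum>j\<in>UNIV. \<Sum>i\<in>UNIV. x $ i * (B $ j $ i * cnj (x $ j)))"
    by (rule sum.swap)
  also have "\<dots> = qform B x"
    by (simp add: qform_def matrix_vector_mult_def sum_distrib_left mult_ac)
  finally show ?thesis
    by (simp only: Reals_cnj_iff)
qed

definition pos_def :: "complex^'n^'n \<Rightarrow> bool" where
  "pos_def B \<longleftrightarrow> hermitian B \<and> (\<forall>x. x \<noteq> 0 \<longrightarrow> 0 < Re (qform B x))"

definition pos_semidef :: "complex^'n^'n \<Rightarrow> bool" where
  "pos_semidef B \<longleftrightarrow> hermitian B \<and> (\<forall>x. 0 \<le> Re (qform B x))"

definition vnorm :: "complex^'n^'n \<Rightarrow> complex^'n \<Rightarrow> real" where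
  "vnorm P x = sqrt (Re (qform P x))"

definition opnorm :: "complex^'n^'n \<Rightarrow> real^'n^'n \<Rightarrow> real" where
  "opnorm P A = max_over {x. x \<noteq> 0} (\<lambda>x. vnorm P (cmat A *v x) / vnorm P x)"

definition dual_norm :: "complex^'n^'n \<Rightarrow> complex^'n \<Rightarrow> real" where
  "dual_norm P y = sqrt (Re (qform (matrix_inv P) y))"


section \<open>The optimisation problems and the Lyapunov data\<close>

definition nu :: "real^'n^'n \<Rightarrow> real^'n^'n \<Rightarrow> real^'n \<Rightarrow> (real^'n) set \<Rightarrow> nat \<Rightarrow> real" where
  "nu A Q q X k = max_over X
     (\<lambda>x. x \<bullet> ((transpose (mat_pow A k) ** Q ** mat_pow A k) *v x) + q \<bullet> (mat_pow A k *v x))"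

definition Pos_s :: "(nat \<Rightarrow> real) \<Rightarrow> nat set" where
  "Pos_s u = {k. u k > 0}"

definition mu :: "(real^'n) set \<Rightarrow> complex^'n^'n \<Rightarrow> real" where
  "mu X P = max_over X (\<lambda>x. Re (qform P (cvec x)))"

definition lyap_mats :: "real^'n^'n \<Rightarrow> (complex^'n^'n) set" where
  "lyap_mats A = {P. pos_def P \<and> pos_def (P - cmat (transpose A) ** P ** cmat A)}"

definition T_set :: "real^'n^'n \<Rightarrow> complex^'n^'n \<Rightarrow> real set" where
  "T_set Q P = {t. 0 \<le> t \<and> pos_semidef (t *\<^sub>R P - cmat Q)}"

definition lyap_pairs :: "real^'n^'n \<Rightarrow> real^'n^'n \<Rightarrow> ((complex^'n^'n) \<times> real) set" where
  "lyap_pairs A Q = {(P, t). P \<in> lyap_mats A \<and> t \<in> T_set Q P}"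

definition H :: "real^'n \<Rightarrow> (real^'n) set \<Rightarrow> complex^'n^'n \<Rightarrow> real \<Rightarrow> real \<Rightarrow> real" where
  "H q X P t x =
    (if t = 0 then x * sqrt (mu X P) * dual_norm P (cvec q)
     else (sqrt (t * mu X P) * x + dual_norm P (cvec q) / (2 * sqrt t))\<^sup>2
          - (dual_norm P (cvec q))\<^sup>2 / (4 * t))"

definition H_inv :: "real^'n \<Rightarrow> (real^'n) set \<Rightarrow> complex^'n^'n \<Rightarrow> real \<Rightarrow> real \<Rightarrow> real" where
  "H_inv q X P t = the_inv_into {0..} (H q X P t)"

definition K_lyap :: "real^'n^'n \<Rightarrow> real^'n^'n \<Rightarrow> real^'n \<Rightarrow> (real^'n) set \<Rightarrow>
    nat \<Rightarrow> complex^'n^'n \<Rightarrow> real \<Rightarrow> int" where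
  "K_lyap A Q q X k P t =
     \<lfloor>ln (H_inv q X P t (nu A Q q X k)) / ln (opnorm P A)\<rfloor> + 1"

text \<open>The minimum of a set of naturals, as a relation: unlike \<^const>\<open>Least\<close> it also asserts that the
  set is nonempty.\<close>

definition is_min_of :: "int \<Rightarrow> nat set \<Rightarrow> bool" where
  "is_min_of m S \<longleftrightarrow> m \<in> int ` S \<and> (\<forall>j\<in>S. m \<le> int j)"

end

theory Submission
  imports Defs
begin

text \<open>
  Write \<open>a = \<parallel>A\<parallel>\<^sub>P\<close>, \<open>m = \<mu>(P)\<close> and \<open>c\<close> for the dual norm of \<open>q\<close>. Expanding the square gives the
  single formula \<open>H(x) = t m x\<^sup>2 + c \<surd>m x\<close> for all \<open>t \<ge> 0\<close>. Since \<open>X\<close> contains a nonzero vector,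
  \<open>m > 0\<close>; and if \<open>t = 0\<close>, then \<open>- Q\<close> is positive semidefinite, hence \<open>q \<noteq> 0\<close> and \<open>c > 0\<close>. Therefore
  \<open>H\<close> is strictly increasing on the nonnegative reals and takes every value between \<open>H(0) = 0\<close> and
  \<open>H(b)\<close> on \<open>[0, b]\<close>.

  The rest follows from the bound \<open>\<nu>\<^sub>j \<le> H(a\<^sup>j)\<close> (\<open>nu_le_H_opnorm_power\<close>), where the quadratic
  part is estimated by \<open>Q \<preceq> t P\<close>, the linear part by the Cauchy-Schwarz inequality for \<open>P\<close>, and
  \<open>\<parallel>A\<^sup>j x\<parallel>\<^sub>P\<close> by \<open>a\<^sup>j \<surd>m\<close>. The number \<open>a\<close> lies strictly between \<open>0\<close> and \<open>1\<close>: the operator norm is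
  attained, so positivity of \<open>P - A\<^sup>T P A\<close> at a maximiser gives \<open>a < 1\<close>, and \<open>a = 0\<close> would mean
  \<open>A = 0\<close>, contrary to the positive spectral radius.

  If \<open>\<nu>\<^sub>k > 0\<close>, then \<open>h = H\<^sup>-\<^sup>1(\<nu>\<^sub>k)\<close> exists, is positive, and satisfies \<open>h \<le> a\<^sup>k\<close> by this bound. Taking
  logarithms, which reverses the order on division by \<open>ln a < 0\<close>, shows for every natural \<open>j\<close> that
  \<open>K \<le> j\<close> holds exactly when \<open>a\<^sup>j < h\<close> (\<open>floor_ln_ratio_le_iff\<close>). Everything claimed about \<open>K\<close>
  is read off this equivalence: \<open>K > k\<close> because \<open>a\<^sup>k < h\<close> fails, \<open>K\<close> is the asserted minimum,
  \<open>j \<ge> K\<close> yields \<open>\<nu>\<^sub>j \<le> H(a\<^sup>j) < \<nu>\<^sub>k\<close>, and a larger \<open>h\<close> gives a smaller \<open>K\<close>.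
\<close>


section \<open>Hermitian forms through the real inner product\<close>

text \<open>The real inner product of \<open>complex^'n\<close> is the real part of the Hermitian one. Using it gives
  access to the bilinearity and continuity rules of real inner product spaces.\<close>

lemma Re_qform: "Re (qform B x) = x \<bullet> (B *v x)"
  by (simp add: qform_def inner_vec_def inner_complex_def)

lemma inner_adjoint:
  fixes B :: "complex^'n^'m"
  shows "x \<bullet> (map_matrix cnj (transpose B) *v y) = (B *v x) \<bullet> y"
proof -
  have "x \<bullet> (map_matrix cnj (transpose B) *v y)
      = (\<Sum>i\<in>UNIV. \<Sum>j\<in>UNIV. Re (cnj (x $ i) * (cnj (B $ j $ i) * y $ j)))"
    by (simp add: inner_vec_def inner_complex_def matrix_vector_mult_def transpose_def
        sum_distrib_left sum.distrib[symmetric])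
  also have "\<dots> = (\<Sum>j\<in>UNIV. \<Sum>i\<in>UNIV. Re (cnj (x $ i) * (cnj (B $ j $ i) * y $ j)))"
    by (rule sum.swap)
  also have "\<dots> = (B *v x) \<bullet> y"
    by (simp add: inner_vec_def inner_complex_def matrix_vector_mult_def
        sum_distrib_left sum_distrib_right sum.distrib[symmetric] algebra_simps)
  finally show ?thesis .
qed

lemma hermitian_inner:
  assumes "hermitian B"
  shows "x \<bullet> (B *v y) = (B *v x) \<bullet> y"
  using inner_adjoint[of x B y] assms by (simp add: hermitian_def)

lemma scaleR_matrix_vector_mult:
  fixes A :: "complex^'n^'m"
  shows "(r *\<^sub>R A) *v x = r *\<^sub>R (A *v x)"
  by (simp add: vec_eq_iff matrix_vector_mult_def scaleR_right.sum)

lemma matrix_vector_mult_scaleR_right: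
  fixes A :: "complex^'n^'m"
  shows "A *v (r *\<^sub>R x) = r *\<^sub>R (A *v x)"
  by (rule linear_cmul) simp

lemma cmat_mult_cvec: "cmat A *v cvec x = cvec (A *v x)"
  by (simp add: vec_eq_iff matrix_vector_mult_def cvec_def)

lemma inner_cvec: "cvec x \<bullet> cvec y = x \<bullet> y"
  by (simp add: inner_vec_def cvec_def inner_complex_def)

lemma cvec_eq_0_iff: "cvec x = 0 \<longleftrightarrow> x = 0"
  by (simp add: vec_eq_iff cvec_def)

lemma continuous_on_cvec: "continuous_on S cvec"
  unfolding cvec_def by (intro continuous_intros continuous_on_vec_lambda)

lemma Re_qform_cmat_cvec: "Re (qform (cmat Q) (cvec x)) = x \<bullet> (Q *v x)"
  by (simp add: Re_qform cmat_mult_cvec inner_cvec)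

lemma continuous_on_Re_qform:
  assumes "continuous_on S f"
  shows "continuous_on S (\<lambda>x. Re (qform B (f x)))"
  unfolding Re_qform
  by (intro continuous_on_inner assms
      bounded_linear.continuous_on[OF matrix_vector_mul_bounded_linear])


section \<open>The norm of a positive definite matrix and its dual\<close>

lemma Re_qform_pos: "pos_def P \<Longrightarrow> x \<noteq> 0 \<Longrightarrow> 0 < Re (qform P x)"
  by (simp add: pos_def_def)

lemma Re_qform_nonneg: "pos_def P \<Longrightarrow> 0 \<le> Re (qform P x)"
  by (cases "x = 0") (auto simp: Re_qform pos_def_def intro: less_imp_le)

lemma vnorm_pos: "pos_def P \<Longrightarrow> x \<noteq> 0 \<Longrightarrow> 0 < vnorm P x"
  by (simp add: vnorm_def Re_qform_pos)

lemma vnorm_nonneg: "pos_def P \<Longrightarrow> 0 \<le> vnorm P x"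
  by (simp add: vnorm_def Re_qform_nonneg)

lemma vnorm_power2: "pos_def P \<Longrightarrow> (vnorm P x)\<^sup>2 = Re (qform P x)"
  by (simp add: vnorm_def Re_qform_nonneg)

lemma vnorm_zero: "vnorm P 0 = 0"
  by (simp add: vnorm_def Re_qform)

lemma vnorm_scaleR: "vnorm P (r *\<^sub>R x) = \<bar>r\<bar> * vnorm P x"
proof -
  have "Re (qform P (r *\<^sub>R x)) = r\<^sup>2 * Re (qform P x)"
    by (simp add: Re_qform matrix_vector_mult_scaleR_right power2_eq_square)
  then show ?thesis
    by (simp add: vnorm_def real_sqrt_mult)
qed

text \<open>The kernel of a positive definite matrix is trivial, so \<open>matrix_inv\<close> is a genuine inverse.\<close>

lemma pos_def_mult_matrix_inv:
  assumes "pos_def P"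
  shows "P *v (matrix_inv P *v y) = y"
proof -
  have "x = 0" if "P *v x = 0" for x
    using that Re_qform_pos[OF assms, of x] by (auto simp: Re_qform)
  then obtain B where B: "B ** P = mat 1"
    using matrix_left_invertible_ker[of P] by blast
  then have "P ** B = mat 1"
    by (simp add: matrix_left_right_inverse)
  with B have "\<exists>C. P ** C = mat 1 \<and> C ** P = mat 1"
    by blast
  then have "P ** matrix_inv P = mat 1"
    unfolding matrix_inv_def by (rule someI2_ex) simp
  then show ?thesis
    by (simp add: matrix_vector_mul_assoc)
qed

text \<open>With \<open>w = P\<^sup>-\<^sup>1 y\<close> the dual norm of \<open>y\<close> is the norm of \<open>w\<close>, because
  \<open>y\<^sup>* P\<^sup>-\<^sup>1 y = (P w)\<^sup>* w\<close>. Its positivity and the duality inequality below thus come from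
  properties of \<open>P\<close> itself.\<close>

lemma dual_norm_eq_vnorm:
  assumes "pos_def P"
  shows "dual_norm P y = vnorm P (matrix_inv P *v y)"
  by (simp add: dual_norm_def vnorm_def Re_qform pos_def_mult_matrix_inv[OF assms] inner_commute)

lemma dual_norm_nonneg: "pos_def P \<Longrightarrow> 0 \<le> dual_norm P y"
  by (simp add: dual_norm_eq_vnorm vnorm_nonneg)

lemma dual_norm_pos:
  assumes "pos_def P" "y \<noteq> 0"
  shows "0 < dual_norm P y"
proof -
  have "matrix_inv P *v y \<noteq> 0"
    using pos_def_mult_matrix_inv[OF assms(1), of y] assms(2) by auto
  then show ?thesis
    by (simp add: dual_norm_eq_vnorm assms(1) vnorm_pos)
qed

lemma Cauchy_Schwarz_pos_def:
  assumes P: "pos_def P"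
  shows "(P *v w) \<bullet> y \<le> vnorm P w * vnorm P y"
proof (cases "w = 0")
  case True
  then show ?thesis by (simp add: vnorm_zero)
next
  case False
  define e where "e = w \<bullet> (P *v w)"
  define s where "s = ((P *v w) \<bullet> y) / e"
  have e: "0 < e"
    using Re_qform_pos[OF P False] by (simp add: e_def Re_qform)
  have sym: "w \<bullet> (P *v y) = (P *v w) \<bullet> y"
    using P by (simp add: pos_def_def hermitian_inner)
  \<comment> \<open>The form is nonnegative at the residual of the \<open>P\<close>-orthogonal projection of \<open>y\<close> to \<open>w\<close>.\<close>
  have "0 \<le> (y - s *\<^sub>R w) \<bullet> (P *v (y - s *\<^sub>R w))"
    using Re_qform_nonneg[OF P, of "y - s *\<^sub>R w"] by (simp add: Re_qform)
  also have "\<dots> = y \<bullet> (P *v y) - 2 * s * ((P *v w) \<bullet> y) + s\<^sup>2 * e"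
    by (simp add: matrix_vector_mult_diff_distrib matrix_vector_mult_scaleR_right inner_diff_left
        inner_diff_right sym e_def inner_commute[of y] power2_eq_square algebra_simps)
  also have "\<dots> = y \<bullet> (P *v y) - ((P *v w) \<bullet> y)\<^sup>2 / e"
    using e by (simp add: s_def power2_eq_square field_simps)
  finally have "((P *v w) \<bullet> y)\<^sup>2 \<le> e * (y \<bullet> (P *v y))"
    using e by (simp add: field_simps)
  also have "\<dots> = (vnorm P w * vnorm P y)\<^sup>2"
    by (simp add: power_mult_distrib vnorm_power2[OF P] Re_qform e_def)
  finally show ?thesis
    by (rule power2_le_imp_le) (simp add: vnorm_nonneg[OF P])
qed

lemma inner_le_dual_norm:
  assumes "pos_def P"
  shows "z \<bullet> y \<le> dual_norm P z * vnorm P y"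
  using Cauchy_Schwarz_pos_def[OF assms, of "matrix_inv P *v z" y]
  by (simp add: pos_def_mult_matrix_inv[OF assms] dual_norm_eq_vnorm[OF assms])


section \<open>The operator norm of a Schur stable matrix\<close>

text \<open>The quotient is invariant under scaling, so its maximum over the unit sphere, which exists by
  compactness, is its maximum over all nonzero vectors.\<close>

lemma opnorm_attained:
  fixes A :: "real^'n^'n"
  assumes P: "pos_def P"
  obtains x where "x \<noteq> 0" "opnorm P A = vnorm P (cmat A *v x) / vnorm P x"
    "\<And>y. y \<noteq> 0 \<Longrightarrow> vnorm P (cmat A *v y) / vnorm P y \<le> opnorm P A"
proof -
  define f where "f x = vnorm P (cmat A *v x) / vnorm P x" for x
  have "continuous_on (sphere 0 1) f"
    unfolding f_def vnorm_def
  proof (intro continuous_on_divide continuous_on_real_sqrt continuous_on_Re_qform ballI)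
    show "sqrt (Re (qform P x)) \<noteq> 0" if "x \<in> sphere 0 1" for x
    proof -
      have "x \<noteq> 0" using that by auto
      then show ?thesis using Re_qform_pos[OF P, of x] by simp
    qed
  qed (rule bounded_linear.continuous_on[OF matrix_vector_mul_bounded_linear] continuous_on_id)+
  moreover have "axis undefined 1 \<in> sphere (0::complex^'n) 1"
    by (simp add: norm_axis_1)
  ultimately obtain x where x: "x \<in> sphere 0 1" "\<And>y. y \<in> sphere 0 1 \<Longrightarrow> f y \<le> f x"
    using continuous_attains_sup[of "sphere (0::complex^'n) 1" f] by auto
  have le: "f y \<le> f x" if "y \<noteq> 0" for y
  proof -
    have "f y = f ((1 / norm y) *\<^sub>R y)"
      using that by (simp add: f_def matrix_vector_mult_scaleR_right vnorm_scaleR)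
    also have "\<dots> \<le> f x"
      using that by (intro x(2)) simp
    finally show ?thesis .
  qed
  have "x \<noteq> 0"
    using x(1) by auto
  moreover have "opnorm P A = f x"
    unfolding opnorm_def f_def[symmetric] by (rule max_over_eqI) (use le \<open>x \<noteq> 0\<close> in auto)
  ultimately show ?thesis
    using that[of x] le by (simp add: f_def)
qed

lemma vnorm_mult_le_opnorm:
  assumes P: "pos_def P"
  shows "vnorm P (cmat A *v x) \<le> opnorm P A * vnorm P x"
proof (cases "x = 0")
  case True
  then show ?thesis by (simp add: vnorm_zero)
next
  case False
  then have "vnorm P (cmat A *v x) / vnorm P x \<le> opnorm P A"
    using opnorm_attained[OF P, of A] by metis
  then show ?thesis
    using vnorm_pos[OF P False] by (simp add: field_simps)
qed

lemma opnorm_nonneg: "pos_def P \<Longrightarrow> 0 \<le> opnorm P A"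
  by (metis opnorm_attained divide_nonneg_nonneg vnorm_nonneg)

lemma opnorm_less_1:
  fixes A :: "real^'n^'n"
  assumes "P \<in> lyap_mats A"
  shows "opnorm P A < 1"
proof -
  have P: "pos_def P" and L: "pos_def (P - cmat (transpose A) ** P ** cmat A)"
    using assms by (auto simp: lyap_mats_def)
  obtain x where x: "x \<noteq> 0" "opnorm P A = vnorm P (cmat A *v x) / vnorm P x"
    using opnorm_attained[OF P, of A] by metis
  have adj: "cmat (transpose A) = map_matrix cnj (transpose (cmat A))"
    by (simp add: vec_eq_iff transpose_def)
  have "Re (qform (P - cmat (transpose A) ** P ** cmat A) x)
      = x \<bullet> (P *v x) - x \<bullet> (map_matrix cnj (transpose (cmat A)) *v (P *v (cmat A *v x)))"
    by (simp only: Re_qform matrix_vector_mult_diff_rdistrib inner_diff_right adj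
        matrix_vector_mul_assoc[symmetric])
  also have "\<dots> = Re (qform P x) - Re (qform P (cmat A *v x))"
    by (simp only: inner_adjoint Re_qform)
  finally have "vnorm P (cmat A *v x) < vnorm P x"
    using Re_qform_pos[OF L x(1)] by (simp add: vnorm_def)
  then show ?thesis
    using x vnorm_pos[OF P x(1)] by simp
qed

text \<open>If the operator norm vanished, then \<open>A\<close> would act as \<open>0\<close> and \<open>0\<close> would be its only
  eigenvalue, so that the spectral radius would be \<open>0\<close> as well.\<close>

lemma opnorm_pos:
  fixes A :: "real^'n^'n"
  assumes P: "pos_def P" and rho: "0 < spectral_radius A"
  shows "0 < opnorm P A"
proof (rule ccontr)
  assume "\<not> 0 < opnorm P A"
  then have "opnorm P A = 0"
    using opnorm_nonneg[OF P, of A] by simp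
  then have "vnorm P (cmat A *v x) \<le> 0" for x
    using vnorm_mult_le_opnorm[OF P, of A x] by simp
  then have zero: "cmat A *v x = 0" for x
    using vnorm_pos[OF P] by (meson not_less)
  have "axis undefined 1 \<noteq> (0::complex^'n)"
    by (simp add: axis_eq_0_iff)
  then have "spectrum (cmat A) = {0}"
    by (auto simp: spectrum_def zero vector_mul_eq_0)
  then have "spectral_radius A = cmod 0"
    unfolding spectral_radius_def by (intro max_over_eqI) auto
  with rho show False
    by simp
qed

lemma vnorm_mat_pow_le:
  assumes P: "pos_def P"
  shows "vnorm P (cvec (mat_pow A k *v x)) \<le> opnorm P A ^ k * vnorm P (cvec x)"
proof (induction k)
  case 0
  then show ?case by simp
next
  case (Suc k)
  have "vnorm P (cvec (mat_pow A (Suc k) *v x)) = vnorm P (cmat A *v cvec (mat_pow A k *v x))"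
    by (simp add: cmat_mult_cvec matrix_vector_mul_assoc)
  also have "\<dots> \<le> opnorm P A * vnorm P (cvec (mat_pow A k *v x))"
    by (rule vnorm_mult_le_opnorm[OF P])
  also have "\<dots> \<le> opnorm P A * (opnorm P A ^ k * vnorm P (cvec x))"
    by (intro mult_left_mono Suc.IH opnorm_nonneg P)
  finally show ?case
    by (simp add: mult.assoc)
qed


section \<open>The function H and the bound on the optimal values\<close>

lemma Re_qform_cvec_le_mu:
  assumes "compact X" "x \<in> X"
  shows "Re (qform P (cvec x)) \<le> mu X P"
proof -
  have "continuous_on X (\<lambda>x. Re (qform P (cvec x)))"
    by (intro continuous_on_Re_qform continuous_on_cvec)
  moreover have "X \<noteq> {}"
    using assms(2) by blast
  ultimately show ?thesis
    using max_over_compact[OF assms(1)] assms(2) unfolding mu_def by metis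
qed

lemma mu_pos:
  assumes "compact X" "X \<noteq> {}" "X \<noteq> {0}" "pos_def P"
  shows "0 < mu X P"
proof -
  obtain x where "x \<in> X" "x \<noteq> 0"
    using assms by blast
  then show ?thesis
    using Re_qform_pos[OF assms(4), of "cvec x"] Re_qform_cvec_le_mu[OF assms(1), of x P]
    by (simp add: cvec_eq_0_iff)
qed

text \<open>Expanding the square removes the term \<open>c\<^sup>2 / (4 t)\<close>, and the resulting polynomial also covers
  the separate case \<open>t = 0\<close>.\<close>

lemma H_eq_quadratic:
  assumes "0 \<le> t" "0 \<le> mu X P"
  shows "H q X P t x = t * mu X P * x\<^sup>2 + sqrt (mu X P) * dual_norm P (cvec q) * x"
proof (cases "t = 0")
  case True
  then show ?thesis by (simp add: H_def)
next
  case False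
  then have t: "0 < sqrt t" and t2: "sqrt t * sqrt t = t"
    using assms by auto
  have m2: "sqrt (mu X P) * sqrt (mu X P) = mu X P"
    using assms by simp
  define s m c where "s = sqrt t" and "m = sqrt (mu X P)" and "c = dual_norm P (cvec q)"
  have "(s * m * x + c / (2 * s))\<^sup>2 - c\<^sup>2 / (4 * (s * s)) = (s * s) * (m * m) * x\<^sup>2 + m * c * x"
    using t by (simp add: s_def[symmetric] power2_eq_square field_simps)
  then show ?thesis
    using False by (simp add: H_def real_sqrt_mult s_def m_def c_def t2 m2 del: real_sqrt_mult_self)
qed

text \<open>For \<open>t > 0\<close> the quadratic term increases strictly. For \<open>t = 0\<close> only the linear term is left;
  then \<open>0 \<in> \<T>\<^sub>Q(P)\<close> says that \<open>- Q\<close> is positive semidefinite, which forces \<open>q \<noteq> 0\<close>.\<close>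

lemma H_strict_mono:
  assumes "compact X" "X \<noteq> {}" "X \<noteq> {0}" "(P, t) \<in> lyap_pairs A Q"
    and "pos_semidef (- cmat Q) \<Longrightarrow> q \<noteq> 0"
  shows "strict_mono_on {0..} (H q X P t)"
proof (rule strict_mono_onI)
  fix x y :: real
  assume xy: "x \<in> {0..}" "y \<in> {0..}" "x < y"
  have P: "pos_def P" and t: "0 \<le> t" and S: "pos_semidef (t *\<^sub>R P - cmat Q)"
    using assms(4) by (auto simp: lyap_pairs_def lyap_mats_def T_set_def)
  have m: "0 < mu X P"
    by (rule mu_pos) fact+
  have sq: "x\<^sup>2 < y\<^sup>2"
    using xy by (simp add: power_strict_mono)
  define b where "b = sqrt (mu X P) * dual_norm P (cvec q)"
  have b0: "0 \<le> b"
    using m dual_norm_nonneg[OF P] by (simp add: b_def)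
  have "t * mu X P * x\<^sup>2 + b * x < t * mu X P * y\<^sup>2 + b * y"
  proof (cases "t = 0")
    case True
    then have "0 < b"
      using S assms(5) dual_norm_pos[OF P, of "cvec q"] m by (simp add: b_def cvec_eq_0_iff)
    then show ?thesis
      using True xy by simp
  next
    case False
    then have "t * mu X P * x\<^sup>2 < t * mu X P * y\<^sup>2"
      using t m sq by simp
    moreover have "b * x \<le> b * y"
      using b0 xy by (simp add: mult_left_mono)
    ultimately show ?thesis
      by (rule add_less_le_mono)
  qed
  then show "H q X P t x < H q X P t y"
    using t m by (simp add: H_eq_quadratic b_def)
qed

lemma H_intermediate_value:
  assumes "0 \<le> t" "0 \<le> mu X P" "0 \<le> b" "0 \<le> v" "v \<le> H q X P t b"
  shows "\<exists>x\<ge>0. x \<le> b \<and> H q X P t x = v"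
proof (rule IVT')
  show "H q X P t 0 \<le> v"
    using assms by (simp add: H_eq_quadratic)
  show "continuous_on {0..b} (H q X P t)"
    using assms by (simp add: H_eq_quadratic continuous_intros)
qed (use assms in auto)

lemma nu_attained:
  assumes "compact X" "X \<noteq> {}"
  obtains x where "x \<in> X"
    "nu A Q q X k = (mat_pow A k *v x) \<bullet> (Q *v (mat_pow A k *v x)) + q \<bullet> (mat_pow A k *v x)"
proof -
  let ?B = "mat_pow A k"
  let ?f = "\<lambda>x. x \<bullet> ((transpose ?B ** Q ** ?B) *v x) + q \<bullet> (?B *v x)"
  have "continuous_on X ?f"
    by (intro continuous_intros)
  then obtain x where x: "x \<in> X" "nu A Q q X k = ?f x"
    using max_over_compact[OF assms, of ?f] unfolding nu_def by auto
  have "x \<bullet> (transpose ?B *v z) = (?B *v x) \<bullet> z" for z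
    by (metis dot_lmul_matrix inner_commute transpose_matrix_vector)
  then have "?f x = (?B *v x) \<bullet> (Q *v (?B *v x)) + q \<bullet> (?B *v x)"
    by (simp only: matrix_vector_mul_assoc[symmetric])
  with x show ?thesis
    using that by metis
qed

text \<open>At a maximiser \<open>x\<close> put \<open>y = A\<^sup>k x\<close>. Then \<open>y\<^sup>T Q y \<le> t \<parallel>y\<parallel>\<^sub>P\<^sup>2\<close> and \<open>q\<^sup>T y \<le> c \<parallel>y\<parallel>\<^sub>P\<close>, and both bounds
  increase with \<open>\<parallel>y\<parallel>\<^sub>P \<le> a\<^sup>k \<surd>m\<close>, at which value they add up to \<open>H(a\<^sup>k)\<close>.\<close>

lemma nu_le_H_opnorm_power:
  assumes X: "compact X" "X \<noteq> {}" and Pt: "(P, t) \<in> lyap_pairs A Q"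
  shows "nu A Q q X k \<le> H q X P t (opnorm P A ^ k)"
proof -
  have P: "pos_def P" and t: "0 \<le> t" and S: "pos_semidef (t *\<^sub>R P - cmat Q)"
    using Pt by (auto simp: lyap_pairs_def lyap_mats_def T_set_def)
  obtain x where x: "x \<in> X"
    "nu A Q q X k = (mat_pow A k *v x) \<bullet> (Q *v (mat_pow A k *v x)) + q \<bullet> (mat_pow A k *v x)"
    using nu_attained[OF X] by metis
  define y where "y = mat_pow A k *v x"
  define a where "a = opnorm P A ^ k"
  define m where "m = mu X P"
  define c where "c = dual_norm P (cvec q)"
  have a: "0 \<le> a"
    using opnorm_nonneg[OF P] by (simp add: a_def)
  have xm: "Re (qform P (cvec x)) \<le> m"
    unfolding m_def by (rule Re_qform_cvec_le_mu) fact+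
  then have m: "0 \<le> m"
    using Re_qform_nonneg[OF P, of "cvec x"] by linarith
  have "vnorm P (cvec y) \<le> a * vnorm P (cvec x)"
    unfolding y_def a_def by (rule vnorm_mat_pow_le[OF P])
  also have "\<dots> \<le> a * sqrt m"
    using xm a by (simp add: vnorm_def mult_left_mono)
  finally have ym: "vnorm P (cvec y) \<le> a * sqrt m" .
  have "0 \<le> Re (qform (t *\<^sub>R P - cmat Q) (cvec y))"
    using S by (simp add: pos_semidef_def)
  also have "\<dots> = t * Re (qform P (cvec y)) - y \<bullet> (Q *v y)"
    by (simp add: Re_qform_cmat_cvec[symmetric])
      (simp add: Re_qform matrix_vector_mult_diff_rdistrib scaleR_matrix_vector_mult inner_diff_right)
  finally have "y \<bullet> (Q *v y) \<le> t * (vnorm P (cvec y))\<^sup>2"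
    by (simp add: vnorm_power2[OF P])
  also have "\<dots> \<le> t * (a * sqrt m)\<^sup>2"
    using ym t vnorm_nonneg[OF P] by (intro mult_left_mono power_mono) auto
  finally have quad: "y \<bullet> (Q *v y) \<le> t * m * a\<^sup>2"
    using m by (simp add: power_mult_distrib mult_ac)
  have "q \<bullet> y \<le> c * vnorm P (cvec y)"
    using inner_le_dual_norm[OF P, of "cvec q" "cvec y"] by (simp add: inner_cvec c_def)
  also have "\<dots> \<le> c * (a * sqrt m)"
    using ym dual_norm_nonneg[OF P] by (intro mult_left_mono) (auto simp: c_def)
  finally have lin: "q \<bullet> y \<le> sqrt m * c * a"
    by (simp add: mult_ac)
  have "nu A Q q X k = y \<bullet> (Q *v y) + q \<bullet> y"
    using x(2) by (simp add: y_def)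
  also have "\<dots> \<le> t * m * a\<^sup>2 + sqrt m * c * a"
    using quad lin by (rule add_mono)
  also have "\<dots> = H q X P t a"
    using t m by (simp add: H_eq_quadratic m_def c_def)
  finally show ?thesis
    by (simp add: a_def)
qed


section \<open>The index computed by logarithms\<close>

lemma floor_ln_ratio_le_iff:
  fixes a h :: real
  assumes "0 < a" "a < 1" "0 < h"
  shows "\<lfloor>ln h / ln a\<rfloor> + 1 \<le> int j \<longleftrightarrow> a ^ j < h"
proof -
  have "\<lfloor>ln h / ln a\<rfloor> + 1 \<le> int j \<longleftrightarrow> \<lfloor>ln h / ln a\<rfloor> < int j"
    by linarith
  also have "\<dots> \<longleftrightarrow> ln h / ln a < real j"
    by (simp add: floor_less_iff)
  also have "\<dots> \<longleftrightarrow> real j * ln a < ln h"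
    using assms by (simp add: neg_divide_less_eq)
  also have "\<dots> \<longleftrightarrow> ln (a ^ j) < ln h"
    using assms by (simp add: ln_realpow)
  also have "\<dots> \<longleftrightarrow> a ^ j < h"
    using assms by (simp add: ln_less_cancel_iff)
  finally show ?thesis .
qed

text \<open>Nonnegativity matters when \<open>S\<close> is the set of all naturals, for which every negative integer
  has the threshold property too.\<close>

lemma is_min_of_threshold:
  assumes "0 \<le> K" "\<And>j. K \<le> int j \<longleftrightarrow> j \<in> S"
  shows "is_min_of K S"
proof -
  have "nat K \<in> S"
    using assms(2)[of "nat K"] assms(1) by simp
  then have "K \<in> int ` S"
    using assms(1) by (intro image_eqI[of _ _ "nat K"]) auto
  then show ?thesis
    using assms(2) by (auto simp: is_min_of_def)
qed


theorem theorem3: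
  fixes A Q :: "real^'n^'n" and q :: "real^'n" and X :: "(real^'n) set"
    and k :: nat and P :: "complex^'n^'n" and t :: real
  assumes "transpose Q = Q"
    and "polytope X" and "X \<noteq> {}" and "X \<noteq> {0}"
    and "0 < spectral_radius A" and "spectral_radius A < 1"
    and "pos_semidef (- cmat Q) \<Longrightarrow> q \<noteq> 0"
    and "\<forall>(P', t') \<in> lyap_pairs A Q. nu A Q q X 0 < H q X P' t' 1"
    and "k \<in> Pos_s (nu A Q q X)"
    and "(P, t) \<in> lyap_pairs A Q"
  shows
    "((\<exists>!x. x \<in> {0..} \<and> H q X P t x = nu A Q q X k) \<and> 0 < H_inv q X P t (nu A Q q X k)
        \<and> 0 < opnorm P A \<and> ln (opnorm P A) \<noteq> 0
        \<and> K_lyap A Q q X k P t \<in> \<nat>)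
     \<and> (is_min_of (K_lyap A Q q X k P t) {j. H q X P t (opnorm P A ^ j) < nu A Q q X k}
        \<and> is_min_of (K_lyap A Q q X k P t) {j. opnorm P A ^ j < H_inv q X P t (nu A Q q X k)})
     \<and> K_lyap A Q q X k P t \<ge> int k + 1
     \<and> (\<forall>j::nat. int j \<ge> K_lyap A Q q X k P t \<longrightarrow> nu A Q q X j < nu A Q q X k)
     \<and> (\<forall>j \<in> Pos_s (nu A Q q X). nu A Q q X j \<le> nu A Q q X k \<longrightarrow>
          K_lyap A Q q X k P t \<le> K_lyap A Q q X j P t)"
proof -
  have X: "compact X"
    using \<open>polytope X\<close> by (rule polytope_imp_compact)
  have P: "pos_def P" and L: "P \<in> lyap_mats A" and t: "0 \<le> t"
    using \<open>(P, t) \<in> lyap_pairs A Q\<close> by (auto simp: lyap_pairs_def lyap_mats_def T_set_def)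
  define a where "a = opnorm P A"
  define v where "v = nu A Q q X"
  define h where "h j = H_inv q X P t (v j)" for j
  define K where "K j = K_lyap A Q q X j P t" for j
  let ?H = "H q X P t"
  have a: "0 < a" "a < 1"
    using opnorm_pos[OF P] opnorm_less_1[OF L] assms(5) by (auto simp: a_def)
  have m: "0 \<le> mu X P"
    using mu_pos[OF X assms(3,4) P] by simp
  have mono: "strict_mono_on {0..} ?H"
    by (rule H_strict_mono[OF X assms(3,4,10,7)])
  have H_less: "?H x < ?H y \<longleftrightarrow> x < y" if "0 \<le> x" "0 \<le> y" for x y
    using strict_mono_on_less[OF mono] that by simp
  have bound: "v j \<le> ?H (a ^ j)" for j
    unfolding v_def a_def by (rule nu_le_H_opnorm_power[OF X assms(3,10)])
  have h: "0 < h j \<and> h j \<le> a ^ j \<and> ?H (h j) = v j" if "0 < v j" for j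
  proof -
    obtain x where x: "0 \<le> x" "x \<le> a ^ j" "?H x = v j"
      using H_intermediate_value[OF t m _ _ bound[of j]] a \<open>0 < v j\<close> by auto
    have "x \<noteq> 0"
      using x(3) \<open>0 < v j\<close> t m by (auto simp: H_eq_quadratic)
    moreover have "h j = x"
      unfolding h_def H_inv_def x(3)[symmetric]
      using x(1) strict_mono_on_imp_inj_on[OF mono] by (simp add: the_inv_into_f_f)
    ultimately show ?thesis
      using x by simp
  qed
  have K_le: "K j \<le> int i \<longleftrightarrow> a ^ i < h j" if "0 < v j" for i j
    using floor_ln_ratio_le_iff[of a "h j" i] a h[OF that]
    by (simp add: K_def K_lyap_def h_def v_def a_def)
  have K_gt: "int j < K j" if "0 < v j" for j
    using K_le[OF that, of j] h[OF that] by simp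
  have vk: "0 < v k"
    using \<open>k \<in> Pos_s (nu A Q q X)\<close> by (simp add: Pos_s_def v_def)
  have H_pow_less: "?H (a ^ j) < v k \<longleftrightarrow> a ^ j < h k" for j
    using h[OF vk] H_less[of "a ^ j" "h k"] a by simp
  have unique: "\<exists>!x. x \<in> {0..} \<and> ?H x = v k"
    using h[OF vk] strict_mono_on_imp_inj_on[OF mono]
    by (intro ex1I[of _ "h k"]) (auto simp: inj_on_def)
  have nat: "K k \<in> \<nat>"
    using K_gt[OF vk] by (simp add: Nats_altdef1)
  have min: "is_min_of (K k) {j. a ^ j < h k}"
    using K_gt[OF vk] K_le[OF vk] by (intro is_min_of_threshold) auto
  have after: "v j < v k" if "K k \<le> int j" for j
    using bound[of j] K_le[OF vk, of j] H_pow_less[of j] that by simp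
  have antimono: "K k \<le> K j" if vj: "0 < v j" and le: "v j \<le> v k" for j
  proof -
    have "h j \<le> h k"
      using H_less[of "h k" "h j"] h[OF vk] h[OF vj] le by auto
    \<comment> \<open>The equivalence \<open>K_le\<close> is about natural indices, and \<open>K j\<close> is one of them.\<close>
    moreover obtain i where "K j = int i"
      using K_gt[OF vj] nonneg_int_cases[of "K j"] by force
    ultimately show ?thesis
      using K_le[OF vk, of i] K_le[OF vj, of i] by simp
  qed
  show ?thesis
    unfolding v_def[symmetric] a_def[symmetric] h_def[symmetric] K_def[symmetric]
    using unique h[OF vk] a nat min K_gt[OF vk] after antimono
    by (simp add: H_pow_less Pos_s_def)
qed

end
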